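(* Let $L \ge 3$ be a prime number. For every integer $N \ge 2$, the period $T^{M,L}_N$ of the M-type Grover walk with $L$ states on the cycle graph $C_N$ satisfies $$T^{M,L}_N = \begin{cases} 2L, & N = L, \\ \infty, & N \neq L. \end{cases}$$
   Context: Let $L \ge 3$ be odd, $m = (L-1)/2$, and $N \ge 2$. The cycle graph $C_N$ has vertex set $\{0,1,\dots,N-1\}$, with vertices identified modulo $N$. Let $\mathcal{H}_P$ be the complex Hilbert space with orthonormal basis $\{|k\rangle : k \in \{0,\dots,N-1\}\}$ (labels read modulo $N$), and let $\mathcal{H}_C$ be the complex Hilbert space with ordered orthonormal basis $(|\leftarrow m\rangle, \dots, |\leftarrow 1\rangle, |\cdot\rangle, |1\rightarrow\rangle, \dots, |m\rightarrow\rangle)$. Put $\mathcal{H} = \mathcal{H}_P \otimes \mathcal{H}_C$. The shift operator $S$ on $\mathcal{H}$ is the linear operator with $S(|k\rangle\otimes|\leftarrow j\rangle) = |k-j\rangle\otimes|\leftarrow j\rangle$ and $S(|k\rangle\otimes|j\rightarrow\rangle) = |k+j\rangle\otimes|j\rightarrow\rangle$ for $j=1,\dots,m$, and $S(|k\rangle\otimes|\cdot\rangle) = |k\rangle\otimes|\cdot\rangle$, where positions are read modulo $N$. The M-type local coin operator is the operator on $\mathcal{H}_C$ whose matrix $A^{M,L}$ in the ordered basis above is the $L\times L$ matrix with every diagonal entry equal to $-(2m-1)/L$ and every off-diagonal entry equal to $2/L$. The coin operator is $C = \sum_{k=0}^{N-1} |k\rangle\langle k| \otimes A^{M,L}$.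 The M-type Grover walk with $L$ states on $C_N$ is the quantum walk with time-evolution operator $U^{M,L}_N = SC$. Its period is $T^{M,L}_N = \inf\{ n \ge 1 : (U^{M,L}_N)^n = I\}$, defined to be $\infty$ if this set is empty. *)

theory Defs
  imports
    "HOL-Computational_Algebra.Primes"
    "HOL-Library.Extended_Nat"
    "Jordan_Normal_Form.Matrix"
begin

text \<open>
  The position space is \<open>carrier_vec N\<close> over the complex numbers, with \<open>|k\<rangle>\<close> being \<open>unit_vec N k\<close>.
  The coin space is \<open>carrier_vec L\<close> with \<open>L = 2 * m + 1\<close>. Its ordered basis is numbered
  from \<open>0\<close>: the left arrow of length \<open>j\<close> is \<open>unit_vec L (m - j)\<close>, the rest state is
  \<open>unit_vec L m\<close>, and the right arrow of length \<open>j\<close> is \<open>unit_vec L (m + j)\<close>. Hence the coin state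
  with number \<open>c\<close> displaces the walker by the integer \<open>c - m\<close>.

  The tensor product is the Kronecker product: \<open>|k\<rangle> \<otimes> |c\<rangle>\<close> is the basis vector of
  \<open>carrier_vec (N * L)\<close> with number \<open>k * L + c\<close>.
\<close>

definition kron_vec :: "complex vec \<Rightarrow> complex vec \<Rightarrow> complex vec" where
  "kron_vec v w = vec (dim_vec v * dim_vec w)
     (\<lambda>i. v $ (i div dim_vec w) * w $ (i mod dim_vec w))"

definition kron_mat :: "complex mat \<Rightarrow> complex mat \<Rightarrow> complex mat" where
  "kron_mat A B = mat (dim_row A * dim_row B) (dim_col A * dim_col B)
     (\<lambda>(i, j). A $$ (i div dim_row B, j div dim_col B) * B $$ (i mod dim_row B, j mod dim_col B))"

definition half_range :: "nat \<Rightarrow> nat" where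
  "half_range L = (L - 1) div 2"

definition moved_position :: "nat \<Rightarrow> nat \<Rightarrow> nat \<Rightarrow> nat \<Rightarrow> nat" where
  "moved_position L N k c = nat ((int k + (int c - int (half_range L))) mod int N)"

definition shift_op :: "nat \<Rightarrow> nat \<Rightarrow> complex mat" where
  "shift_op L N = mat (N * L) (N * L)
     (\<lambda>(i, j). if i = moved_position L N (j div L) (j mod L) * L + j mod L then 1 else 0)"

definition local_coin_M :: "nat \<Rightarrow> complex mat" where
  "local_coin_M L = mat L L
     (\<lambda>(a, b). if a = b then - ((2 * of_nat (half_range L) - 1) / of_nat L) else 2 / of_nat L)"

definition position_proj :: "nat \<Rightarrow> nat \<Rightarrow> complex mat" where
  "position_proj N k = mat N N (\<lambda>(a, b). if a = k \<and> b = k then 1 else 0)"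

text \<open>Matrices with dimensions in their carrier form no type-class monoid, so the
  sum of operators over the positions is taken entrywise.\<close>

definition coin_op_M :: "nat \<Rightarrow> nat \<Rightarrow> complex mat" where
  "coin_op_M L N = mat (N * L) (N * L)
     (\<lambda>(i, j). \<Sum>k<N. kron_mat (position_proj N k) (local_coin_M L) $$ (i, j))"

definition grover_walk_M :: "nat \<Rightarrow> nat \<Rightarrow> complex mat" where
  "grover_walk_M L N = shift_op L N * coin_op_M L N"

text \<open>In \<^typ>\<open>enat\<close> the infimum of the empty set is \<open>\<infinity>\<close>.\<close>

definition period_M :: "nat \<Rightarrow> nat \<Rightarrow> enat" where
  "period_M L N = Inf (enat ` {n. n \<ge> 1 \<and> grover_walk_M L N ^\<^sub>m n = 1\<^sub>m (N * L)})"


text \<open>The operators act on the tensor basis as intended.\<close>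

lemma index_less_prod:
  fixes k N c L :: nat
  assumes "k < N" "c < L"
  shows "k * L + c < N * L"
proof -
  have "k * L + c < Suc k * L" using assms by simp
  also have "\<dots> \<le> N * L" using assms by (intro mult_right_mono) auto
  finally show ?thesis .
qed

lemma kron_vec_unit:
  assumes "k < N" "c < L"
  shows "kron_vec (unit_vec N k) (unit_vec L c) = unit_vec (N * L) (k * L + c)"
proof (rule eq_vecI)
  fix i assume "i < dim_vec (unit_vec (N * L) (k * L + c) :: complex vec)"
  then have i: "i < N * L" by simp
  have "i div L < N" using i by (simp add: less_mult_imp_div_less)
  moreover have "i mod L < L" using assms by simp
  moreover have "i = k * L + c \<longleftrightarrow> i div L = k \<and> i mod L = c"
    using assms by (auto simp: div_mult_mod_eq)
  ultimately show "kron_vec (unit_vec N k) (unit_vec L c) $ i = unit_vec (N * L) (k * L + c) $ i"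
    using i assms by (auto simp: kron_vec_def unit_vec_def)
qed (simp add: kron_vec_def)

lemma moved_position_less: "N > 0 \<Longrightarrow> moved_position L N k c < N"
  by (simp add: moved_position_def nat_less_iff)

lemma shift_op_basis:
  assumes "k < N" "c < L"
  shows "shift_op L N *\<^sub>v kron_vec (unit_vec N k) (unit_vec L c) =
         kron_vec (unit_vec N (moved_position L N k c)) (unit_vec L c)"
proof -
  have "moved_position L N k c < N" using assms by (simp add: moved_position_less)
  then show ?thesis
    using assms index_less_prod[OF assms]
    by (auto simp: kron_vec_unit index_less_prod shift_op_def intro!: eq_vecI)
qed

lemma shift_op_left:
  assumes "L = 2 * m + 1" "k < N" "1 \<le> j" "j \<le> m"
  shows "shift_op L N *\<^sub>v kron_vec (unit_vec N k) (unit_vec L (m - j)) =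
         kron_vec (unit_vec N (nat ((int k - int j) mod int N))) (unit_vec L (m - j))"
  using shift_op_basis[of k N "m - j" L] assms
  by (simp add: moved_position_def half_range_def of_nat_diff)

lemma shift_op_rest:
  assumes "L = 2 * m + 1" "k < N"
  shows "shift_op L N *\<^sub>v kron_vec (unit_vec N k) (unit_vec L m) =
         kron_vec (unit_vec N k) (unit_vec L m)"
  using shift_op_basis[of k N m L] assms
  by (simp add: moved_position_def half_range_def)

lemma shift_op_right:
  assumes "L = 2 * m + 1" "k < N" "1 \<le> j" "j \<le> m"
  shows "shift_op L N *\<^sub>v kron_vec (unit_vec N k) (unit_vec L (m + j)) =
         kron_vec (unit_vec N ((k + j) mod N)) (unit_vec L (m + j))"
  using shift_op_basis[of k N "m + j" L] assms
  by (simp add: moved_position_def half_range_def nat_mod_distrib nat_add_distrib)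

lemma coin_op_M_basis:
  assumes "k < N" "c < L"
  shows "coin_op_M L N *\<^sub>v kron_vec (unit_vec N k) (unit_vec L c) =
         kron_vec (unit_vec N k) (local_coin_M L *\<^sub>v unit_vec L c)"
proof (rule eq_vecI)
  show "dim_vec (coin_op_M L N *\<^sub>v kron_vec (unit_vec N k) (unit_vec L c)) =
        dim_vec (kron_vec (unit_vec N k) (local_coin_M L *\<^sub>v unit_vec L c))"
    by (simp add: coin_op_M_def kron_vec_def local_coin_M_def)
next
  fix i assume "i < dim_vec (kron_vec (unit_vec N k) (local_coin_M L *\<^sub>v unit_vec L c))"
  then have i: "i < N * L" by (simp add: kron_vec_def local_coin_M_def)
  have iN: "i div L < N" using i by (simp add: less_mult_imp_div_less)
  have iL: "i mod L < L" using assms by simp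
  have "(coin_op_M L N *\<^sub>v kron_vec (unit_vec N k) (unit_vec L c)) $ i =
        coin_op_M L N $$ (i, k * L + c)"
    using i assms index_less_prod[OF assms] by (simp add: kron_vec_unit coin_op_M_def)
  also have "\<dots> = (\<Sum>k'<N. (if i div L = k' \<and> k = k' then 1 else 0) * local_coin_M L $$ (i mod L, c))"
    using i iN iL assms index_less_prod[OF assms]
    by (simp add: coin_op_M_def kron_mat_def position_proj_def local_coin_M_def cong: sum.cong)
  also have "\<dots> = (\<Sum>k'<N. if k' = k then (if i div L = k then local_coin_M L $$ (i mod L, c) else 0) else 0)"
    by (rule sum.cong) auto
  also have "\<dots> = (if i div L = k then local_coin_M L $$ (i mod L, c) else 0)"
    using assms by simp
  also have "\<dots> = kron_vec (unit_vec N k) (local_coin_M L *\<^sub>v unit_vec L c) $ i"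
    using i iN iL assms by (simp add: kron_vec_def local_coin_M_def)
  finally show "(coin_op_M L N *\<^sub>v kron_vec (unit_vec N k) (unit_vec L c)) $ i =
      kron_vec (unit_vec N k) (local_coin_M L *\<^sub>v unit_vec L c) $ i" .
qed

end

theory Submission
  imports Defs "Jordan_Normal_Form.Schur_Decomposition"
begin

text \<open>
  Plane waves \<open>x \<mapsto> z\<^sup>x\<close> with \<open>z\<^sup>N = 1\<close> reduce the walk to the \<open>L \<times> L\<close> blocks
  \<open>B\<^sub>z = D (2/L J - I)\<close>, where \<open>J\<close> is the all-ones matrix and \<open>D\<close> is diagonal with the entries
  \<open>z\<^sup>m, \<dots>, z\<^sup>-\<^sup>m\<close>; the walk has \<open>U\<^sup>n = I\<close> iff every \<open>B\<^sub>z\<^sup>n = I\<close>.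

  If \<open>U\<^sup>n = I\<close>, then the trace \<open>(2/L - 1) s(z)\<close> of \<open>B\<^sub>z\<close>, with \<open>s(z) = z\<^sup>m + \<dots> + z\<^sup>-\<^sup>m\<close>, is a sum of
  roots of unity, and since \<open>L\<close> is odd this makes \<open>s(z)/L\<close> an algebraic integer. The even power sums of
  the numbers \<open>s(z)/L\<close> over all \<open>z\<close> are then rational algebraic integers, hence integers. As
  \<open>s(1)/L = 1\<close> and \<open>s(z)/L\<close> is real of absolute value less than \<open>1\<close> for \<open>z \<noteq> 1\<close>, letting the exponent
  grow shows \<open>s(z) = 0\<close>, that is \<open>z\<^sup>L = 1\<close>, for all \<open>z \<noteq> 1\<close>. Hence \<open>N\<close> divides \<open>L\<close>.

  If \<open>N = L\<close>, then \<open>B\<^sub>1\<close> has order 2. For \<open>z \<noteq> 1\<close> the power sums of the diagonal of \<open>D\<close> vanish in degrees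
  \<open>1, \<dots>, L - 1\<close>, so in the expansion of \<open>B\<^sub>z\<^sup>n\<close> with \<open>n \<le> L\<close> only the terms with at most one factor \<open>J\<close>
  survive; this gives \<open>B\<^sub>z\<^sup>L = I\<close>, and as \<open>L\<close> is prime the order is \<open>L\<close>.
\<close>

section \<open>Cyclotomic integers\<close>

text \<open>Multiplication by \<open>p\<close> on the integer polynomials modulo
  \<open>x ^ M - 1\<close> has an integer matrix \<open>A\<close>. The powers of \<open>w\<close>
  form an eigenvector of it with eigenvalue \<open>p(w)\<close>, which is thus a root of the monic
  integer polynomial \<open>char_poly A\<close>.\<close>

lemma algebraic_int_poly_root_of_unity:
  fixes w :: "'a :: field_char_0"
  assumes w: "w ^ M = 1" and M: "M > 0"
  shows "algebraic_int (poly (map_poly of_int p) w)"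
proof -
  let ?x = "poly (map_poly of_int p) w"
  let ?B = "\<lambda>i l. \<Sum>j\<le>degree p. if (i + j) mod M = l then coeff p j else 0"
  define A where "A = mat M M (\<lambda>(i, l). ?B i l)"
  define v where "v = vec M (\<lambda>i. w ^ i)"
  have A: "A \<in> carrier_mat M M" by (simp add: A_def)
  have wmod: "w ^ (k mod M) = w ^ k" for k
  proof -
    have "w ^ k = w ^ (M * (k div M) + k mod M)" by simp
    also have "\<dots> = w ^ (k mod M)" unfolding power_add power_mult w by simp
    finally show ?thesis by simp
  qed
  have "eigenvector (map_mat of_int A) v ?x"
    unfolding eigenvector_def
  proof (intro conjI)
    \<comment> \<open>Entry \<open>0\<close> of \<open>v\<close> is
      \<open>w ^ 0 = 1\<close>.\<close>
    have "v $ 0 \<noteq> 0\<^sub>v M $ 0" using M by (simp add: v_def)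
    then show "v \<noteq> 0\<^sub>v (dim_row (map_mat of_int A))" using A by auto
    show "map_mat of_int A *\<^sub>v v = ?x \<cdot>\<^sub>v v"
    proof (rule eq_vecI)
      fix i assume "i < dim_vec (?x \<cdot>\<^sub>v v)"
      then have i: "i < M" by (simp add: v_def)
      have "(map_mat of_int A *\<^sub>v v) $ i = (\<Sum>l<M. of_int (?B i l) * w ^ l)"
        using i by (simp add: A_def v_def scalar_prod_def atLeast0LessThan)
      also have "\<dots> = (\<Sum>l<M. \<Sum>j\<le>degree p. if (i + j) mod M = l then of_int (coeff p j) * w ^ l else 0)"
        by (simp add: sum_distrib_right if_distrib if_distribR cong: if_cong)
      also have "\<dots> = (\<Sum>j\<le>degree p. of_int (coeff p j) * w ^ ((i + j) mod M))"
        using M by (subst sum.swap) simp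
      also have "\<dots> = ?x * w ^ i"
        by (simp add: wmod poly_altdef degree_map_poly coeff_map_poly sum_distrib_left power_add mult_ac)
      finally show "(map_mat of_int A *\<^sub>v v) $ i = (?x \<cdot>\<^sub>v v) $ i"
        using i by (simp add: v_def)
    qed (simp add: A_def v_def)
  qed (simp add: A_def v_def)
  then have "poly (char_poly (map_mat of_int A)) ?x = 0"
    using eigenvalue_root_char_poly[of "map_mat of_int A" M ?x] A by (auto simp: eigenvalue_def)
  then have "poly (map_poly of_int (char_poly A)) ?x = 0"
    by (simp add: of_int_hom.char_poly_hom[OF A])
  moreover have "lead_coeff (char_poly A) = 1"
    using degree_monic_char_poly[OF A] by simp
  ultimately show ?thesis
    unfolding algebraic_int_altdef_ipoly by blast
qed

text \<open>For positive \<open>M\<close> this is the ring of integer combinations of powers of a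
  primitive \<open>M\<close>-th root of unity. As an image of integer polynomials it inherits
  closure under sums and products, so that integrality has to be checked only once for the whole
  ring.\<close>

definition cyclotomic_ints :: "nat \<Rightarrow> complex set" where
  "cyclotomic_ints M = range (\<lambda>p. poly (map_poly of_int p) (cis (2 * pi / real M)))"

lemma cis_root_of_unity: "M > 0 \<Longrightarrow> cis (2 * pi / real M) ^ M = 1"
  by (simp add: DeMoivre)

lemma cyclotomic_ints_algebraic_int:
  "M > 0 \<Longrightarrow> x \<in> cyclotomic_ints M \<Longrightarrow> algebraic_int x"
  unfolding cyclotomic_ints_def
  using algebraic_int_poly_root_of_unity[OF cis_root_of_unity] by auto

lemma of_int_in_cyclotomic_ints: "of_int a \<in> cyclotomic_ints M"
  unfolding cyclotomic_ints_def by (rule range_eqI[of _ _ "[:a:]"]) (cases "a = 0"; simp add: map_poly_pCons)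

lemma cyclotomic_ints_add:
  "x \<in> cyclotomic_ints M \<Longrightarrow> y \<in> cyclotomic_ints M \<Longrightarrow> x + y \<in> cyclotomic_ints M"
  unfolding cyclotomic_ints_def
  by (auto simp flip: poly_add of_int_poly_hom.hom_add)

lemma cyclotomic_ints_mult:
  "x \<in> cyclotomic_ints M \<Longrightarrow> y \<in> cyclotomic_ints M \<Longrightarrow> x * y \<in> cyclotomic_ints M"
  unfolding cyclotomic_ints_def
  by (auto simp flip: poly_mult of_int_poly_hom.hom_mult)

lemma cyclotomic_ints_diff:
  "x \<in> cyclotomic_ints M \<Longrightarrow> y \<in> cyclotomic_ints M \<Longrightarrow> x - y \<in> cyclotomic_ints M"
  using cyclotomic_ints_add[OF _ cyclotomic_ints_mult[OF of_int_in_cyclotomic_ints[of "-1"]]]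
  by fastforce

lemma cyclotomic_ints_power: "x \<in> cyclotomic_ints M \<Longrightarrow> x ^ k \<in> cyclotomic_ints M"
  using of_int_in_cyclotomic_ints[of 1] by (induction k) (auto intro: cyclotomic_ints_mult)

lemma cyclotomic_ints_sum:
  "(\<And>i. i \<in> I \<Longrightarrow> f i \<in> cyclotomic_ints M) \<Longrightarrow> sum f I \<in> cyclotomic_ints M"
  using of_int_in_cyclotomic_ints[of 0]
  by (induction I rule: infinite_finite_induct) (auto intro: cyclotomic_ints_add)

lemma cyclotomic_ints_sum_list:
  "set xs \<subseteq> cyclotomic_ints M \<Longrightarrow> sum_list xs \<in> cyclotomic_ints M"
  using of_int_in_cyclotomic_ints[of 0] by (induction xs) (auto intro: cyclotomic_ints_add)

text \<open>As \<open>n\<close> divides \<open>M\<close>, \<open>z\<close> is an \<open>M\<close>-th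
  root of unity, hence a power of the generator, that is, the value of a monomial.\<close>

lemma root_of_unity_in_cyclotomic_ints:
  assumes "M > 0" "z ^ n = 1" "n dvd M"
  shows "z \<in> cyclotomic_ints M"
proof -
  obtain d where "M = n * d" using assms(3) by blast
  then have "z ^ M = 1" using assms(2) by (simp add: power_mult)
  then have "z \<in> (\<lambda>k. cis (2 * pi * real k / real M)) ` {..<M}"
    using bij_betw_roots_unity[OF assms(1)] by (simp add: bij_betw_def)
  then obtain k where "z = cis (2 * pi / real M) ^ k"
    by (auto simp: DeMoivre mult_ac)
  then show ?thesis
    unfolding cyclotomic_ints_def
    by (intro range_eqI[of _ _ "monom 1 k"]) (simp add: poly_monom map_poly_monom)
qed

text \<open>Schur triangularization gives \<open>A = P * B * Q\<close> with the eigenvalues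
  \<open>es\<close> on the diagonal of \<open>B\<close>, and the trace is invariant under
  similarity. An eigenvector for \<open>e\<close> is fixed by \<open>A ^\<^sub>m k\<close>, which
  forces \<open>e ^ k = 1\<close>.\<close>

lemma trace_finite_order:
  fixes A :: "complex mat"
  assumes A: "A \<in> carrier_mat n n" and k: "A ^\<^sub>m k = 1\<^sub>m n"
  shows "\<exists>es. (\<forall>e \<in> set es. e ^ k = 1) \<and> (\<Sum>i<n. A $$ (i, i)) = sum_list es"
proof -
  obtain es where es: "char_poly A = (\<Prod>e\<leftarrow>es. [:- e, 1:])" "length es = n"
    using char_poly_factorized[OF A] by blast
  obtain B P Q where "schur_decomposition A es = (B, P, Q)"
    by (cases "schur_decomposition A es") auto
  with schur_decomposition[OF A es(1)]
  have sim: "similar_mat_wit A B P Q" and diag: "diag_mat B = es" by auto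
  note wit = similar_mat_witD2[OF A sim]
  define C where "C = P * B"
  have C: "C \<in> carrier_mat n n" using wit(5,6) by (simp add: C_def)
  have "(\<Sum>i<n. A $$ (i, i)) = (\<Sum>i<n. \<Sum>j<n. C $$ (i, j) * Q $$ (j, i))"
    unfolding wit(3) C_def[symmetric]
    using C wit(7) by (auto simp: scalar_prod_def atLeast0LessThan intro!: sum.cong)
  also have "\<dots> = (\<Sum>j<n. (Q * C) $$ (j, j))"
    using C wit(7)
    by (subst sum.swap) (auto simp: scalar_prod_def atLeast0LessThan mult.commute intro!: sum.cong)
  also have "Q * C = Q * P * B"
    using wit(5-7) by (simp add: C_def)
  also have "\<dots> = B" using wit(2,5) by simp
  also have "(\<Sum>j<n. B $$ (j, j)) = sum_list es"
    using wit(5) by (simp flip: diag add: diag_mat_def interv_sum_list_conv_sum_set_nat atLeast0LessThan)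
  finally have "(\<Sum>i<n. A $$ (i, i)) = sum_list es" .
  moreover have "e ^ k = 1" if "e \<in> set es" for e
  proof -
    have "poly (char_poly A) e = 0"
      using that unfolding es by (auto simp: poly_prod_list prod_list_zero_iff)
    then obtain v where v: "eigenvector A v e"
      using eigenvalue_root_char_poly[OF A] by (auto simp: eigenvalue_def)
    then have vn: "v \<in> carrier_vec n" "v \<noteq> 0\<^sub>v n" using A by (auto simp: eigenvector_def)
    then obtain i where i: "i < n" "v $ i \<noteq> 0" by (metis carrier_vecD eq_vecI index_zero_vec)
    have "v = e ^ k \<cdot>\<^sub>v v" using eigenvector_pow[OF A v, of k] k vn by simp
    then have "v $ i = e ^ k * v $ i" using i vn by (metis carrier_vecD index_smult_vec(1))
    then show ?thesis using i by simp
  qed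
  ultimately show ?thesis by blast
qed

section \<open>Sums of powers of roots of unity\<close>

lemma power_int_mod_period:
  fixes z :: "'a :: field"
  assumes "z ^ N = 1" "N > 0"
  shows "z powi (a mod int N) = z powi a"
proof -
  have z: "z \<noteq> 0" using assms by (auto simp: power_0_left)
  have "z powi a = z powi (int N * (a div int N) + a mod int N)" by simp
  also have "\<dots> = z powi (a mod int N)"
    unfolding power_int_add[OF disjI1[OF z]] power_int_mult power_int_of_nat assms by simp
  finally show ?thesis by simp
qed

lemma cis_powi_eq_1_iff:
  assumes "N > 0"
  shows "cis (2 * pi / real N) powi a = 1 \<longleftrightarrow> int N dvd a"
proof -
  let ?u = "cis (2 * pi / real N)"
  define k where "k = nat (a mod int N)"
  have k: "k < N" "int k = a mod int N" using assms by (auto simp: k_def nat_less_iff)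
  have "?u powi a = ?u powi int k"
    by (simp only: k power_int_mod_period[OF cis_root_of_unity[OF assms] assms])
  also have "\<dots> = cis (2 * pi * real k / real N)"
    unfolding power_int_of_nat by (simp add: DeMoivre mult_ac)
  also have "\<dots> = 1 \<longleftrightarrow> k = 0"
    using bij_betw_roots_unity[OF assms] k assms
    by (auto simp: bij_betw_def dest: inj_onD[of _ _ k 0])
  also have "\<dots> \<longleftrightarrow> int N dvd a" using k by (metis dvd_eq_mod_eq_0 of_nat_eq_0_iff)
  finally show ?thesis .
qed

text \<open>Orthogonality of the characters of the cyclic group of order \<open>N\<close>.\<close>

lemma sum_roots_of_unity_powi:
  assumes "N > 0"
  shows "(\<Sum>z | z ^ N = 1. z powi a) = (if int N dvd a then of_nat N else (0::complex))"
proof (cases "int N dvd a")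
  case True
  have "z powi a = 1" if "z ^ N = 1" for z :: complex
    using True that by (auto simp: power_int_mult elim!: dvdE)
  then show ?thesis using True card_roots_unity_eq[OF assms] by simp
next
  case False
  \<comment> \<open>Substituting \<open>u * z\<close> for \<open>z\<close> permutes the roots and
    multiplies the sum by \<open>u powi a\<close>, which differs from \<open>1\<close>; so the sum
    is \<open>0\<close>.\<close>
  define u where "u = cis (2 * pi / real N)"
  have u: "u ^ N = 1" "u \<noteq> 0" using cis_root_of_unity[OF assms] by (auto simp: u_def)
  have "(\<Sum>z | z ^ N = 1. z powi a) = (\<Sum>z | z ^ N = 1. (u * z) powi a)"
    using u by (intro sum.reindex_bij_witness[of _ "\<lambda>z. u * z" "\<lambda>z. z / u"])
      (auto simp: power_mult_distrib power_divide)
  also have "\<dots> = u powi a * (\<Sum>z | z ^ N = 1. z powi a)"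
    by (simp add: power_int_mult_distrib sum_distrib_left)
  finally show ?thesis using cis_powi_eq_1_iff[OF assms, of a] False by (simp add: u_def)
qed

section \<open>The Dirichlet kernel at roots of unity\<close>

definition step_sum :: "nat \<Rightarrow> complex \<Rightarrow> complex" where
  "step_sum L z = (\<Sum>c<L. z powi (int (half_range L) - int c))"

text \<open>The summand is a Laurent polynomial in \<open>z\<close> with integer coefficients, and
  each monomial sums to \<open>0\<close> or \<open>N\<close>. The free exponent \<open>a\<close>
  absorbs the monomials of one factor \<open>step_sum L z\<close> in the induction on
  \<open>r\<close>.\<close>

lemma step_sum_moment_Ints:
  assumes "N > 0"
  shows "(\<Sum>z | z ^ N = 1. z powi a * step_sum L z ^ r) \<in> \<int>"
proof (induction r arbitrary: a)
  case 0
  then show ?case using sum_roots_of_unity_powi[OF assms] by simp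
next
  case (Suc r)
  have "(\<Sum>z | z ^ N = 1. z powi a * step_sum L z ^ Suc r)
      = (\<Sum>z | z ^ N = 1. \<Sum>c<L. z powi (a + (int (half_range L) - int c)) * step_sum L z ^ r)"
  proof (rule sum.cong[OF refl])
    fix z :: complex assume "z \<in> {z. z ^ N = 1}"
    then have z: "z \<noteq> 0" using assms by (auto simp: power_0_left)
    have "z powi a * step_sum L z ^ Suc r = z powi a * step_sum L z * step_sum L z ^ r"
      by simp
    also have "z powi a * step_sum L z = (\<Sum>c<L. z powi (a + (int (half_range L) - int c)))"
      unfolding step_sum_def sum_distrib_left by (simp only: power_int_add[OF disjI1[OF z]])
    finally show "z powi a * step_sum L z ^ Suc r
        = (\<Sum>c<L. z powi (a + (int (half_range L) - int c)) * step_sum L z ^ r)"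
      by (simp add: sum_distrib_right)
  qed
  also have "\<dots> = (\<Sum>c<L. \<Sum>z | z ^ N = 1. z powi (a + (int (half_range L) - int c)) * step_sum L z ^ r)"
    by (rule sum.swap)
  also have "\<dots> \<in> \<int>" by (intro Ints_sum Suc.IH)
  finally show ?case .
qed

lemma half_range_odd: "odd L \<Longrightarrow> int L = 2 * int (half_range L) + 1"
  unfolding half_range_def by (auto elim!: oddE)

lemma step_sum_1: "step_sum L 1 = of_nat L"
  by (simp add: step_sum_def)

text \<open>Multiplied by \<open>z - 1\<close>, the geometric sum telescopes to a unit times
  \<open>z ^ L - 1\<close>.\<close>

lemma step_sum_eq_0_iff:
  assumes "odd L" "z \<noteq> 0" "z \<noteq> 1"
  shows "step_sum L z = 0 \<longleftrightarrow> z ^ L = 1"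
proof -
  let ?m = "int (half_range L)"
  have "(z - 1) * step_sum L z = (\<Sum>c<L. z powi (?m + 1 - int c) - z powi (?m + 1 - int (Suc c)))"
    unfolding step_sum_def sum_distrib_left
  proof (rule sum.cong[OF refl])
    fix c
    have "z powi (?m + 1 - int c) = z powi (?m - int c + 1)" by (simp add: algebra_simps)
    then show "(z - 1) * z powi (?m - int c) = z powi (?m + 1 - int c) - z powi (?m + 1 - int (Suc c))"
      unfolding power_int_add_1[OF disjI1[OF assms(2)]] by (simp add: algebra_simps)
  qed
  also have "\<dots> = z powi (?m + 1) - z powi (?m + 1 - int L)"
    by (subst sum_lessThan_telescope') simp
  also have "z powi (?m + 1) = z powi (?m + 1 - int L + int L)" by simp
  also have "\<dots> = z powi (?m + 1 - int L) * z ^ L"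
    unfolding power_int_add[OF disjI1[OF assms(2)]] by simp
  finally have "(z - 1) * step_sum L z = z powi (?m + 1 - int L) * (z ^ L - 1)"
    by (simp add: algebra_simps)
  then have "(z - 1) * step_sum L z = 0 \<longleftrightarrow> z powi (?m + 1 - int L) * (z ^ L - 1) = 0" by simp
  then show ?thesis using assms(2,3) by simp
qed

text \<open>On the unit circle conjugation inverts \<open>z\<close>, and for odd \<open>L\<close>
  the reflection \<open>c \<mapsto> L - 1 - c\<close> negates all exponents, so the sum is its own
  conjugate.\<close>

lemma step_sum_real:
  assumes "odd L" "norm z = 1"
  shows "step_sum L z = of_real (Re (step_sum L z))"
proof -
  let ?m = "int (half_range L)"
  have inv: "cnj z = inverse z" using divide_conv_cnj[OF assms(2), of 1] by (simp add: divide_inverse)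
  have "cnj (step_sum L z) = (\<Sum>c<L. z powi (int c - ?m))"
    unfolding step_sum_def
    by (simp add: inv power_int_inverse flip: power_int_minus)
  also have "\<dots> = step_sum L z"
    unfolding step_sum_def using half_range_odd[OF assms(1)]
    by (intro sum.reindex_bij_witness[of _ "\<lambda>c. L - 1 - c" "\<lambda>c. L - 1 - c"]) (auto simp: of_nat_diff)
  finally have "step_sum L z \<in> \<real>" by (simp add: Reals_cnj_iff)
  then show ?thesis by (simp add: of_real_Re)
qed

lemma abs_Re_step_sum_less:
  assumes "odd L" "L \<ge> 3" "norm z = 1" "z \<noteq> 1"
  shows "\<bar>Re (step_sum L z)\<bar> < real L"
proof -
  let ?m = "half_range L"
  let ?f = "\<lambda>c. Re (z powi (int ?m - int c))"
  have m: "?m < L" "?m \<ge> 1" using half_range_odd[OF assms(1)] assms(2) by auto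
  have bound: "\<bar>?f c\<bar> \<le> 1" for c
    using abs_Re_le_cmod[of "z powi (int ?m - int c)"] assms(3) by (simp add: norm_power_int)
  have lt1: "Re z < 1"
  proof (rule ccontr)
    assume "\<not> Re z < 1"
    with complex_Re_le_cmod[of z] assms(3) have "Re z = 1" by simp
    with cmod_power2[of z] assms(3) have "Im z = 0" by simp
    with \<open>Re z = 1\<close> assms(4) show False by (simp add: complex_eq_iff)
  qed
  have eq: "Re (step_sum L z) = (\<Sum>c<L. ?f c)" by (simp add: step_sum_def)
  have "(\<Sum>c<L. ?f c) < (\<Sum>c<L. 1)"
  proof (rule sum_strict_mono_ex1)
    show "\<forall>c\<in>{..<L}. ?f c \<le> 1" using bound by (auto simp: abs_le_iff)
    \<comment> \<open>The index \<open>?m - 1\<close> has exponent \<open>1\<close>, so its term is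
      \<open>Re z\<close>.\<close>
    show "\<exists>c\<in>{..<L}. ?f c < 1" using m lt1
      by (intro bexI[of _ "?m - 1"]) (auto simp: of_nat_diff)
  qed simp
  moreover have "(\<Sum>c<L. - 1) < (\<Sum>c<L. ?f c)"
  proof (rule sum_strict_mono_ex1)
    show "\<forall>c\<in>{..<L}. - 1 \<le> ?f c" using bound by (auto simp: abs_le_iff)
    \<comment> \<open>The index \<open>?m\<close> has exponent \<open>0\<close>, so its term is
      \<open>1\<close>.\<close>
    show "\<exists>c\<in>{..<L}. - 1 < ?f c" using m by (intro bexI[of _ ?m]) auto
  qed simp
  ultimately show ?thesis unfolding eq by (simp add: abs_less_iff)
qed

text \<open>The even power sums are nonnegative integers that tend to \<open>0\<close>, so one of
  them is \<open>0\<close>, and then so is each of its nonnegative summands.\<close>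

lemma integral_even_power_sums_imp_zero:
  fixes y :: "'a \<Rightarrow> real"
  assumes "finite F" and less: "\<And>z. z \<in> F \<Longrightarrow> \<bar>y z\<bar> < 1"
    and int: "\<And>r. (\<Sum>z\<in>F. y z ^ (2 * r)) \<in> \<int>" and "z \<in> F"
  shows "y z = 0"
proof -
  have "(\<lambda>r. \<Sum>z\<in>F. (y z ^ 2) ^ r) \<longlonglongrightarrow> (\<Sum>z\<in>F. 0)"
    using less by (intro tendsto_sum LIMSEQ_realpow_zero) (auto simp: abs_square_less_1)
  then have "\<forall>\<^sub>F r in sequentially. (\<Sum>z\<in>F. y z ^ (2 * r)) < 1"
    unfolding power_mult by (rule order_tendstoD(2)) simp
  then obtain r where r: "(\<Sum>z\<in>F. y z ^ (2 * r)) < 1"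
    by (auto simp: eventually_sequentially)
  have "(\<Sum>z\<in>F. y z ^ (2 * r)) \<ge> 0" by (intro sum_nonneg) simp
  with r int[of r] have "(\<Sum>z\<in>F. y z ^ (2 * r)) = 0" by (auto elim!: Ints_cases)
  with assms(1,4) have "y z ^ (2 * r) = 0"
    by (subst (asm) sum_nonneg_eq_0_iff) auto
  then show ?thesis by simp
qed

lemma step_sum_integral_imp_zero:
  assumes L: "odd L" "L \<ge> 3" and "N > 0" "M > 0"
    and integral: "\<And>z. z ^ N = 1 \<Longrightarrow> step_sum L z / of_nat L \<in> cyclotomic_ints M"
    and z: "z ^ N = 1" "z \<noteq> 1"
  shows "step_sum L z = 0"
proof -
  define R where "R = {z::complex. z ^ N = 1}"
  define y where "y z = Re (step_sum L z) / real L" for z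
  have R: "finite R" "1 \<in> R" using finite_roots_unity[of N] \<open>N > 0\<close> by (auto simp: R_def)
  have norm: "norm z = 1" if "z \<in> R" for z
  proof -
    have "norm z ^ N = 1 ^ N" using that by (simp add: R_def flip: norm_power)
    then show ?thesis using \<open>N > 0\<close> by (intro power_eq_imp_eq_base[of "norm z" N 1]) auto
  qed
  have y: "step_sum L z / of_nat L = of_real (y z)" if "z \<in> R" for z
    using step_sum_real[OF L(1) norm[OF that]] by (simp add: y_def)
  have "(\<Sum>z\<in>R - {1}. y z ^ (2 * r)) \<in> \<int>" for r
  proof -
    let ?S = "\<Sum>z\<in>R. (step_sum L z / of_nat L) ^ (2 * r)"
    have "?S \<in> cyclotomic_ints M"
      using integral by (intro cyclotomic_ints_sum cyclotomic_ints_power) (simp add: R_def)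
    then have "algebraic_int ?S" by (rule cyclotomic_ints_algebraic_int[OF \<open>M > 0\<close>])
    \<comment> \<open>The power sum is symmetric in all \<open>N\<close>-th roots of unity: an
      integer moment divided by a power of \<open>L\<close>.\<close>
    moreover have "?S \<in> \<rat>"
    proof -
      have "?S = (\<Sum>z\<in>R. z powi 0 * step_sum L z ^ (2 * r)) / of_nat L ^ (2 * r)"
        by (simp add: power_divide sum_divide_distrib)
      then show ?thesis
        using step_sum_moment_Ints[OF \<open>N > 0\<close>, of 0 L "2 * r"] Ints_subset_Rats
        by (auto simp: R_def)
    qed
    ultimately have "?S \<in> \<int>" by (rule rational_algebraic_int_is_int)
    also have "?S = of_real (\<Sum>z\<in>R. y z ^ (2 * r))" using y by simp
    \<comment> \<open>The root \<open>1\<close> has \<open>y 1 = 1\<close> and violates the strict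
      bound; splitting it off changes the sum by an integer.\<close>
    also have "(\<Sum>z\<in>R. y z ^ (2 * r)) = 1 + (\<Sum>z\<in>R - {1}. y z ^ (2 * r))"
      using R L(2) by (subst sum.remove) (auto simp: y_def step_sum_1)
    finally have "1 + (\<Sum>z\<in>R - {1}. y z ^ (2 * r)) \<in> \<int>"
      unfolding of_real_in_Ints_iff .
    then have "1 + (\<Sum>z\<in>R - {1}. y z ^ (2 * r)) - 1 \<in> \<int>"
      by (rule Ints_diff) simp
    then show ?thesis by simp
  qed
  moreover have "\<bar>y z\<bar> < 1" if "z \<in> R - {1}" for z
    using abs_Re_step_sum_less[OF L norm, of z] that L(2) by (simp add: y_def abs_divide)
  ultimately have "y z = 0"
    using R z by (intro integral_even_power_sums_imp_zero[of "R - {1}"]) (auto simp: R_def)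
  then show ?thesis using y[of z] z L by (simp add: R_def)
qed

section \<open>Powers of the blocks\<close>

lemma pow_mat_add:
  assumes "A \<in> carrier_mat n n"
  shows "A ^\<^sub>m (i + j) = A ^\<^sub>m i * A ^\<^sub>m j"
proof (induction j)
  case 0
  then show ?case using assms by (simp add: right_mult_one_mat[OF pow_carrier_mat[OF assms]])
next
  case (Suc j)
  then show ?case using assms by (simp add: assoc_mult_mat[of _ n n _ n _ n])
qed

lemma pow_mat_mult_eq_1:
  assumes "A \<in> carrier_mat n n" "A ^\<^sub>m i = 1\<^sub>m n"
  shows "A ^\<^sub>m (i * k) = 1\<^sub>m n"
  using assms by (induction k) (auto simp: pow_mat_add)

text \<open>By Bezout, \<open>A\<close> is a quotient of powers equal to the identity. Used to find
  exact orders of blocks that are not the identity.\<close>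

lemma pow_mat_coprime_eq_1:
  assumes A: "A \<in> carrier_mat n n" and "A ^\<^sub>m i = 1\<^sub>m n" "A ^\<^sub>m j = 1\<^sub>m n"
    and "coprime i j" "i > 0"
  shows "A = 1\<^sub>m n"
proof -
  obtain x y where xy: "i * x = j * y + 1"
    using bezout_nat[of i j] assms(4,5) by (auto simp: coprime_iff_gcd_eq_1)
  have "1\<^sub>m n = A ^\<^sub>m (j * y + 1)"
    using pow_mat_mult_eq_1[OF A assms(2)] xy by metis
  also have "\<dots> = A"
    using A by (simp add: pow_mat_add[OF A] pow_mat_mult_eq_1[OF A assms(3)])
  finally show ?thesis by simp
qed

lemma power_coprime_eq_1:
  fixes z :: "'a :: monoid_mult"
  assumes "z ^ i = 1" "z ^ j = 1" "coprime i j" "i > 0"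
  shows "z = 1"
proof -
  obtain x y where xy: "i * x = j * y + 1"
    using bezout_nat[of i j] assms(3,4) by (auto simp: coprime_iff_gcd_eq_1)
  have "1 = z ^ (i * x)" using assms(1) by (simp add: power_mult)
  also have "\<dots> = z" unfolding xy power_add power_mult assms by simp
  finally show ?thesis by simp
qed

section \<open>Powers of a diagonal matrix times the Grover coin\<close>

definition walk_block :: "nat \<Rightarrow> (nat \<Rightarrow> complex) \<Rightarrow> complex mat" where
  "walk_block L d = mat L L (\<lambda>(a, b). d a * (2 / of_nat L - (if a = b then 1 else 0)))"

lemma walk_block_carrier [simp]: "walk_block L d \<in> carrier_mat L L"
  by (simp add: walk_block_def)

lemma walk_block_dim [simp]:
  "dim_row (walk_block L d) = L" "dim_col (walk_block L d) = L"
  by (simp_all add: walk_block_def)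

lemma walk_block_mult_vec_carrier [simp]:
  "w \<in> carrier_vec L \<Longrightarrow> walk_block L d *\<^sub>v w \<in> carrier_vec L"
  by (rule mult_mat_vec_carrier[OF walk_block_carrier])

lemma walk_block_neq_1:
  assumes "d 0 \<noteq> 0" "L \<ge> 2"
  shows "walk_block L d \<noteq> 1\<^sub>m L"
proof
  assume "walk_block L d = 1\<^sub>m L"
  then have "walk_block L d $$ (0, 1) = 1\<^sub>m L $$ (0, 1)" by simp
  then show False using assms by (simp add: walk_block_def)
qed

text \<open>Expand the power of \<open>D (2/L J - I)\<close> into words. A word with two factors
  \<open>J\<close> contains some \<open>J D^i J\<close>, which is the \<open>i\<close>-th power sum
  of \<open>d\<close> times \<open>J\<close> and vanishes because \<open>0 < i < n \<le> L\<close>.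
  What remains is the word without \<open>J\<close> and the \<open>n\<close> words with a single
  \<open>J\<close>, at position \<open>i\<close>.\<close>

lemma walk_block_pow_index:
  assumes moments: "\<And>i. 0 < i \<Longrightarrow> i < L \<Longrightarrow> (\<Sum>c<L. d c ^ i) = 0"
    and "n \<le> L" "a < L" "b < L"
  shows "(walk_block L d ^\<^sub>m n) $$ (a, b) = (if a = b then (- d a) ^ n else 0)
    - 2 / of_nat L * (- 1) ^ n * (\<Sum>i<n. d a ^ Suc i * d b ^ (n - Suc i))"
  using assms(2-)
proof (induction n arbitrary: b)
  case 0
  then show ?case by (simp add: walk_block_def)
next
  case (Suc n)
  let ?B = "walk_block L d ^\<^sub>m n"
  \<comment> \<open>This row sum is what a further factor \<open>J\<close> picks up. The words that
    already contain \<open>J\<close> contribute power sums of degrees \<open>n - i\<close> between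
    \<open>1\<close> and \<open>n < L\<close>, hence nothing.\<close>
  have "(\<Sum>c<L. ?B $$ (a, c) * d c)
      = (\<Sum>c<L. (if a = c then (- d a) ^ n * d a else 0)
          - 2 / of_nat L * (- 1) ^ n * (\<Sum>i<n. d a ^ Suc i * d c ^ (n - i)))"
  proof (rule sum.cong[OF refl])
    fix c assume "c \<in> {..<L}"
    then have "?B $$ (a, c) * d c = ((if a = c then (- d a) ^ n else 0)
        - 2 / of_nat L * (- 1) ^ n * (\<Sum>i<n. d a ^ Suc i * d c ^ (n - Suc i))) * d c"
      using Suc.IH[of c] Suc.prems by simp
    also have "(\<Sum>i<n. d a ^ Suc i * d c ^ (n - i)) = (\<Sum>i<n. d a ^ Suc i * d c ^ (n - Suc i)) * d c"
      unfolding sum_distrib_right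
    proof (rule sum.cong[OF refl])
      fix i assume "i \<in> {..<n}"
      then have "n - i = Suc (n - Suc i)" by auto
      then show "d a ^ Suc i * d c ^ (n - i) = d a ^ Suc i * d c ^ (n - Suc i) * d c" by simp
    qed
    ultimately show "?B $$ (a, c) * d c = (if a = c then (- d a) ^ n * d a else 0)
        - 2 / of_nat L * (- 1) ^ n * (\<Sum>i<n. d a ^ Suc i * d c ^ (n - i))"
      by (simp add: left_diff_distrib)
  qed
  also have "\<dots> = (- d a) ^ n * d a
      - 2 / of_nat L * (- 1) ^ n * (\<Sum>c<L. \<Sum>i<n. d a ^ Suc i * d c ^ (n - i))"
    using Suc.prems by (simp only: sum_subtractf sum_distrib_left[symmetric]) simp
  also have "(\<Sum>c<L. \<Sum>i<n. d a ^ Suc i * d c ^ (n - i))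
      = (\<Sum>i<n. d a ^ Suc i * (\<Sum>c<L. d c ^ (n - i)))"
    by (subst sum.swap) (simp only: sum_distrib_left)
  also have "\<dots> = 0" using Suc.prems by (intro sum.neutral) (auto simp: moments)
  finally have row: "(\<Sum>c<L. ?B $$ (a, c) * d c) = (- 1) ^ n * d a ^ Suc n"
    by (simp add: power_minus[of "d a"] mult_ac)
  have "(walk_block L d ^\<^sub>m Suc n) $$ (a, b) = (\<Sum>c<L. ?B $$ (a, c) * walk_block L d $$ (c, b))"
    using Suc.prems pow_carrier_mat[OF walk_block_carrier[of L d], of n]
    by (auto simp: scalar_prod_def atLeast0LessThan walk_block_def intro!: sum.cong)
  also have "\<dots> = (\<Sum>c<L. 2 / of_nat L * (?B $$ (a, c) * d c) - (if c = b then ?B $$ (a, c) * d c else 0))"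
    using Suc.prems by (intro sum.cong) (auto simp: walk_block_def algebra_simps)
  \<comment> \<open>The first term is the new summand \<open>i = n\<close>, with \<open>J\<close> in
    the last factor; the second comes from \<open>- I\<close>.\<close>
  also have "\<dots> = 2 / of_nat L * ((- 1) ^ n * d a ^ Suc n) - ?B $$ (a, b) * d b"
    unfolding sum_subtractf sum_distrib_left[symmetric] row using Suc.prems by simp
  also have "?B $$ (a, b) * d b = (if a = b then (- d a) ^ n * d a else 0)
      - 2 / of_nat L * (- 1) ^ n * ((\<Sum>i<n. d a ^ Suc i * d b ^ (n - Suc i)) * d b)"
    using Suc.IH[of b] Suc.prems by (simp add: left_diff_distrib)
  also have "(\<Sum>i<n. d a ^ Suc i * d b ^ (n - Suc i)) * d b = (\<Sum>i<n. d a ^ Suc i * d b ^ (n - i))"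
    unfolding sum_distrib_right
  proof (rule sum.cong[OF refl])
    fix i assume "i \<in> {..<n}"
    then have "n - i = Suc (n - Suc i)" by auto
    then show "d a ^ Suc i * d b ^ (n - Suc i) * d b = d a ^ Suc i * d b ^ (n - i)" by simp
  qed
  finally show ?case by (cases "a = b") (simp_all add: algebra_simps)
qed

text \<open>At \<open>n = L\<close> the sum over \<open>i\<close> is \<open>d a\<close> times the
  quotient of \<open>d a ^ L - d b ^ L = 0\<close> by \<open>d a - d b\<close> off the diagonal, and
  \<open>L\<close> on it. The diagonal entry is therefore \<open>- 1 + 2 = 1\<close>.\<close>

lemma walk_block_pow_L:
  assumes moments: "\<And>i. 0 < i \<Longrightarrow> i < L \<Longrightarrow> (\<Sum>c<L. d c ^ i) = 0"
    and one: "\<And>c. d c ^ L = 1" and inj: "inj_on d {..<L}" and "odd L"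
  shows "walk_block L d ^\<^sub>m L = 1\<^sub>m L"
proof (rule eq_matI)
  fix a b assume "a < dim_row (1\<^sub>m L :: complex mat)" "b < dim_col (1\<^sub>m L :: complex mat)"
  then have ab: "a < L" "b < L" by auto
  have minus: "(- d a) ^ L = - 1" using \<open>odd L\<close> one[of a] by (simp add: power_minus_odd)
  have sum: "(\<Sum>i<L. d a ^ Suc i * d b ^ (L - Suc i)) = (if a = b then of_nat L else 0)"
  proof (cases "a = b")
    case True
    have "d a ^ Suc i * d a ^ (L - Suc i) = 1" if "i < L" for i
    proof -
      have "d a ^ Suc i * d a ^ (L - Suc i) = d a ^ (Suc i + (L - Suc i))"
        by (rule power_add[symmetric])
      then show ?thesis using that one[of a] by simp
    qed
    then show ?thesis using True by simp
  next
    case False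
    have "(d a - d b) * (\<Sum>i<L. d b ^ (L - Suc i) * d a ^ i) = d a ^ L - d b ^ L"
      by (rule power_diff_sumr2[symmetric])
    moreover have "d a \<noteq> d b" using inj ab False by (auto dest: inj_onD)
    ultimately have "(\<Sum>i<L. d b ^ (L - Suc i) * d a ^ i) = 0" by (simp add: one)
    then have "d a * (\<Sum>i<L. d b ^ (L - Suc i) * d a ^ i) = 0" by simp
    then show ?thesis using False by (simp add: sum_distrib_left mult_ac)
  qed
  have "(walk_block L d ^\<^sub>m L) $$ (a, b) = (if a = b then (- d a) ^ L else 0)
      - 2 / of_nat L * (- 1) ^ L * (\<Sum>i<L. d a ^ Suc i * d b ^ (L - Suc i))"
    by (rule walk_block_pow_index[OF _ order_refl ab]) (rule moments)
  then show "(walk_block L d ^\<^sub>m L) $$ (a, b) = 1\<^sub>m L $$ (a, b)"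
    unfolding sum minus using \<open>odd L\<close> ab by (auto simp: odd_pos)
qed (auto simp: walk_block_def)

text \<open>With \<open>q = 2/L\<close>, the square of \<open>q J - I\<close> is
  \<open>(q^2 L - 2 q) J + I\<close>, and \<open>q^2 L = 2 q\<close>.\<close>

lemma walk_block_involution:
  assumes "L > 0"
  shows "walk_block L (\<lambda>_. 1) ^\<^sub>m 2 = 1\<^sub>m L"
proof (rule eq_matI)
  fix a b assume "a < dim_row (1\<^sub>m L :: complex mat)" "b < dim_col (1\<^sub>m L :: complex mat)"
  then have ab: "a < L" "b < L" by auto
  let ?q = "2 / of_nat L :: complex"
  have "(walk_block L (\<lambda>_. 1) ^\<^sub>m 2) $$ (a, b)
      = (\<Sum>c<L. (?q - (if a = c then 1 else 0)) * (?q - (if c = b then 1 else 0)))"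
    using ab by (simp add: numeral_2_eq_2 walk_block_def scalar_prod_def atLeast0LessThan)
  also have "\<dots> = (\<Sum>c<L. ?q * ?q - (if a = c then ?q else 0) - (if c = b then ?q else 0)
      + (if c = a then if a = b then 1 else 0 else 0))"
    by (intro sum.cong) (auto simp: algebra_simps)
  also have "\<dots> = of_nat L * (?q * ?q) - ?q - ?q + (if a = b then 1 else 0)"
    using ab by (simp add: sum_subtractf sum.distrib)
  also have "\<dots> = 1\<^sub>m L $$ (a, b)" using ab assms by simp
  finally show "(walk_block L (\<lambda>_. 1) ^\<^sub>m 2) $$ (a, b) = 1\<^sub>m L $$ (a, b)" .
qed (auto simp: walk_block_def)

text \<open>Amplitude in coin state \<open>c\<close> reaches \<open>x\<close> from
  \<open>x - (c - m)\<close>, where a plane wave has the extra factor \<open>z^(m - c)\<close>;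
  hence the sign of the exponent.\<close>

definition step_phase :: "nat \<Rightarrow> complex \<Rightarrow> nat \<Rightarrow> complex" where
  "step_phase L z c = z powi (int (half_range L) - int c)"

lemma step_phase_1: "step_phase L 1 = (\<lambda>_. 1)"
  by (simp add: step_phase_def fun_eq_iff)

lemma trace_walk_block_phase:
  "(\<Sum>i<L. walk_block L (step_phase L z) $$ (i, i)) = (2 / of_nat L - 1) * step_sum L z"
  by (simp add: walk_block_def step_sum_def step_phase_def sum_distrib_left mult.commute)

lemma walk_block_phase_pow_L:
  assumes "prime L" "odd L" "z ^ L = 1" "z \<noteq> 1"
  shows "walk_block L (step_phase L z) ^\<^sub>m L = 1\<^sub>m L"
proof (rule walk_block_pow_L)
  have z: "z \<noteq> 0" using assms(3) prime_gt_0_nat[OF assms(1)] by (auto simp: power_0_left)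
  \<comment> \<open>As \<open>L\<close> is prime, \<open>z\<close> has order exactly
    \<open>L\<close>. This yields both the vanishing power sums and the distinctness of the
    phases.\<close>
  have neq: "z ^ i \<noteq> 1" if "0 < i" "i < L" for i
  proof -
    have "\<not> L dvd i" using that by (auto dest: dvd_imp_le)
    then have "coprime i L" using prime_imp_coprime[OF assms(1)] coprime_commute by blast
    then show ?thesis using power_coprime_eq_1[of z i L] that assms(3,4) by auto
  qed
  show "(\<Sum>c<L. step_phase L z c ^ i) = 0" if "0 < i" "i < L" for i
  proof -
    have "(\<Sum>c<L. step_phase L z c ^ i) = step_sum L (z ^ i)"
      by (simp add: step_sum_def step_phase_def power_int_power power_int_power' mult.commute)
    also have "\<dots> = 0"
      using step_sum_eq_0_iff[of L "z ^ i"] assms(2,3) z neq[OF that]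
      by (simp flip: power_mult add: mult.commute[of i] power_mult)
    finally show ?thesis .
  qed
  show "step_phase L z c ^ L = 1" for c
    using assms(3) by (simp add: step_phase_def power_int_power' mult.commute[of _ "int L"] power_int_mult)
  show "inj_on (step_phase L z) {..<L}"
  proof (rule linorder_inj_onI)
    fix a b assume ab: "a < b" "a \<in> {..<L}" "b \<in> {..<L}"
    let ?k = "int (half_range L) - int b"
    have "step_phase L z a = z powi (?k + int (b - a))"
      using ab by (simp add: step_phase_def of_nat_diff)
    also have "\<dots> = step_phase L z b * z ^ (b - a)"
      unfolding power_int_add[OF disjI1[OF z]] by (simp add: step_phase_def)
    finally show "step_phase L z a \<noteq> step_phase L z b"
      using neq[of "b - a"] ab z by (auto simp: step_phase_def)
  qed auto
qed (fact assms)

section \<open>Fourier decomposition of the walk\<close>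

lemma moved_position_eq_iff:
  assumes "k < N" "x < N"
  shows "x = moved_position L N k c \<longleftrightarrow> k = nat ((int x + (int (half_range L) - int c)) mod int N)"
proof -
  let ?s = "int c - int (half_range L)"
  have "x = moved_position L N k c \<longleftrightarrow> int x = (int k + ?s) mod int N"
    using assms by (auto simp: moved_position_def)
  also have "\<dots> \<longleftrightarrow> int x mod int N = (int k + ?s) mod int N" using assms by simp
  also have "\<dots> \<longleftrightarrow> (int x - ?s) mod int N = int k mod int N"
    by (simp add: mod_eq_dvd_iff algebra_simps)
  also have "\<dots> \<longleftrightarrow> k = nat ((int x + (int (half_range L) - int c)) mod int N)"
    using assms by (auto simp: algebra_simps)
  finally show ?thesis .
qed

lemma local_coin_M_index:
  assumes "odd L" "a < L" "b < L"
  shows "local_coin_M L $$ (a, b) = 2 / of_nat L - (if a = b then 1 else 0)"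
proof -
  have "of_nat L = (of_int (int L) :: complex)" by simp
  also have "\<dots> = 2 * of_nat (half_range L) + 1" unfolding half_range_odd[OF assms(1)] by simp
  finally have "- ((2 * of_nat (half_range L) - 1) / of_nat L) = (2 - of_nat L) / (of_nat L :: complex)"
    by (simp add: minus_divide_left)
  also have "\<dots> = 2 / of_nat L - 1" using assms(2) by (simp add: diff_divide_distrib)
  finally show ?thesis using assms by (simp add: local_coin_M_def)
qed

lemma grover_walk_M_carrier [simp]: "grover_walk_M L N \<in> carrier_mat (N * L) (N * L)"
  by (auto simp: grover_walk_M_def shift_op_def coin_op_M_def)

lemma grover_walk_M_index:
  assumes i: "i < N * L" and j: "j < N * L"
  shows "grover_walk_M L N $$ (i, j) =
    (if i div L = moved_position L N (j div L) (i mod L) then local_coin_M L $$ (i mod L, j mod L) else 0)"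
proof -
  \<comment> \<open>The coin keeps the position of \<open>j\<close> and the shift keeps the coin
    state of \<open>i\<close>, so this is the only intermediate index that contributes.\<close>
  let ?l = "j div L * L + i mod L"
  have "L > 0" using i by (cases L) auto
  have jN: "j div L < N" using j by (simp add: less_mult_imp_div_less)
  then have l: "?l < N * L" using \<open>L > 0\<close> by (intro index_less_prod) auto
  have coin: "coin_op_M L N $$ (l, j)
      = (if l div L = j div L then local_coin_M L $$ (l mod L, j mod L) else 0)" if "l < N * L" for l
  proof -
    have dims: "dim_row (local_coin_M L) = L" "dim_col (local_coin_M L) = L"
      by (simp_all add: local_coin_M_def)
    have "coin_op_M L N $$ (l, j) = (\<Sum>k<N. (if l div L = k \<and> j div L = k then 1 else 0)
        * local_coin_M L $$ (l mod L, j mod L))"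
      using that j by (simp add: coin_op_M_def kron_mat_def position_proj_def dims less_mult_imp_div_less)
    also have "\<dots> = (\<Sum>k<N. if k = j div L then
        if l div L = j div L then local_coin_M L $$ (l mod L, j mod L) else 0 else 0)"
      by (intro sum.cong) auto
    finally show ?thesis using jN by simp
  qed
  have "grover_walk_M L N $$ (i, j) = (\<Sum>l<N * L. shift_op L N $$ (i, l) * coin_op_M L N $$ (l, j))"
    using i j by (simp add: grover_walk_M_def shift_op_def coin_op_M_def scalar_prod_def atLeast0LessThan)
  also have "\<dots> = (\<Sum>l<N * L. if l = ?l then shift_op L N $$ (i, ?l) * coin_op_M L N $$ (?l, j) else 0)"
  proof (rule sum.cong[OF refl])
    fix l assume "l \<in> {..<N * L}"
    then have l: "l < N * L" by simp
    have "shift_op L N $$ (i, l) * coin_op_M L N $$ (l, j) = 0" if "l \<noteq> ?l"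
    proof (cases "l div L = j div L")
      case True
      then have "l mod L \<noteq> i mod L" using that by (metis div_mult_mod_eq)
      then have "i \<noteq> moved_position L N (l div L) (l mod L) * L + l mod L" using \<open>L > 0\<close> by auto
      then show ?thesis using i l by (simp add: shift_op_def)
    qed (use coin[OF l] in simp)
    then show "shift_op L N $$ (i, l) * coin_op_M L N $$ (l, j)
        = (if l = ?l then shift_op L N $$ (i, ?l) * coin_op_M L N $$ (?l, j) else 0)" by auto
  qed
  also have "\<dots> = shift_op L N $$ (i, ?l) * coin_op_M L N $$ (?l, j)" using l by simp
  also have "coin_op_M L N $$ (?l, j) = local_coin_M L $$ (i mod L, j mod L)"
    using coin[OF l] \<open>L > 0\<close> by simp
  also have "shift_op L N $$ (i, ?l)
      = (if i = moved_position L N (j div L) (i mod L) * L + i mod L then 1 else 0)"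
    using i l \<open>L > 0\<close> by (simp add: shift_op_def)
  also have "i = moved_position L N (j div L) (i mod L) * L + i mod L
      \<longleftrightarrow> i div L = moved_position L N (j div L) (i mod L)"
    using \<open>L > 0\<close> by (metis add_right_cancel div_mult_mod_eq mult_cancel2 less_numeral_extra(3))
  finally show ?thesis by simp
qed

section \<open>Plane waves on the cycle\<close>

lemma sum_lessThan_mult_div_mod:
  fixes f :: "nat \<Rightarrow> nat \<Rightarrow> 'a :: comm_monoid_add"
  shows "(\<Sum>j<N * L. f (j div L) (j mod L)) = (\<Sum>k<N. \<Sum>b<L. f k b)"
  unfolding sum.cartesian_product
  by (rule sum.reindex_bij_witness[of _ "\<lambda>(k, b). k * L + b" "\<lambda>j. (j div L, j mod L)"])
    (auto simp: index_less_prod less_mult_imp_div_less intro!: mod_less_divisor gr0I)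

definition plane_wave :: "nat \<Rightarrow> complex \<Rightarrow> complex vec \<Rightarrow> complex vec" where
  "plane_wave N z w = kron_vec (vec N (\<lambda>x. z ^ x)) w"

lemma plane_wave_carrier [simp]: "w \<in> carrier_vec L \<Longrightarrow> plane_wave N z w \<in> carrier_vec (N * L)"
  by (auto simp: plane_wave_def kron_vec_def)

lemma plane_wave_dim [simp]: "dim_vec (plane_wave N z w) = N * dim_vec w"
  by (simp add: plane_wave_def kron_vec_def)

lemma plane_wave_index:
  "w \<in> carrier_vec L \<Longrightarrow> i < N * L \<Longrightarrow> plane_wave N z w $ i = z ^ (i div L) * w $ (i mod L)"
  by (simp add: plane_wave_def kron_vec_def less_mult_imp_div_less)

text \<open>The walk commutes with translations, so it preserves each character \<open>z\<close> of
  the cycle and acts on the coin part alone.\<close>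

lemma grover_walk_M_plane_wave:
  assumes "odd L" "z ^ N = 1" and w: "w \<in> carrier_vec L"
  shows "grover_walk_M L N *\<^sub>v plane_wave N z w
    = plane_wave N z (walk_block L (step_phase L z) *\<^sub>v w)"
proof (rule eq_vecI)
  let ?B = "walk_block L (step_phase L z)"
  have Bw: "?B *\<^sub>v w \<in> carrier_vec L" using w by simp
  show "dim_vec (grover_walk_M L N *\<^sub>v plane_wave N z w) = dim_vec (plane_wave N z (?B *\<^sub>v w))"
    using carrier_matD(1)[OF grover_walk_M_carrier[of L N]] Bw by simp
  fix i assume "i < dim_vec (plane_wave N z (?B *\<^sub>v w))"
  then have i: "i < N * L" using Bw by simp
  let ?x = "i div L" and ?c = "i mod L"
  have "L > 0" "N > 0" using i by (auto intro!: gr0I)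
  have x: "?x < N" using i by (simp add: less_mult_imp_div_less)
  have c: "?c < L" using \<open>L > 0\<close> by simp
  have z: "z \<noteq> 0" using assms(2) \<open>N > 0\<close> by (auto simp: power_0_left)
  \<comment> \<open>The only position from which the walker reaches \<open>?x\<close> in coin state
    \<open>?c\<close>. Its reduction modulo \<open>N\<close> is harmless since
    \<open>z ^ N = 1\<close>.\<close>
  define k0 where "k0 = nat ((int ?x + (int (half_range L) - int ?c)) mod int N)"
  have k0: "k0 < N" "int k0 = (int ?x + (int (half_range L) - int ?c)) mod int N"
    using \<open>N > 0\<close> by (auto simp: k0_def nat_less_iff)
  have "(grover_walk_M L N *\<^sub>v plane_wave N z w) $ i
      = (\<Sum>j<N * L. grover_walk_M L N $$ (i, j) * plane_wave N z w $ j)"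
    using i w carrier_matD[OF grover_walk_M_carrier[of L N]]
    by (simp add: scalar_prod_def atLeast0LessThan)
  also have "\<dots> = (\<Sum>j<N * L. if j div L = k0 then
      local_coin_M L $$ (?c, j mod L) * (z ^ k0 * w $ (j mod L)) else 0)"
    using i x w moved_position_eq_iff[OF _ x, of _ L ?c]
    by (intro sum.cong) (auto simp: grover_walk_M_index plane_wave_index less_mult_imp_div_less k0_def)
  also have "\<dots> = (\<Sum>k<N. \<Sum>b<L. if k = k0 then local_coin_M L $$ (?c, b) * (z ^ k0 * w $ b) else 0)"
    by (rule sum_lessThan_mult_div_mod)
  also have "\<dots> = (\<Sum>k<N. if k = k0 then \<Sum>b<L. local_coin_M L $$ (?c, b) * (z ^ k0 * w $ b) else 0)"
    by (intro sum.cong) auto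
  also have "\<dots> = z ^ k0 * (\<Sum>b<L. local_coin_M L $$ (?c, b) * w $ b)"
    using k0(1) by (simp add: sum_distrib_left mult_ac)
  also have "z ^ k0 = z powi int k0" by simp
  also have "\<dots> = z powi (int ?x + (int (half_range L) - int ?c))"
    unfolding k0(2) by (rule power_int_mod_period[OF assms(2) \<open>N > 0\<close>])
  also have "\<dots> = z ^ ?x * step_phase L z ?c"
    unfolding power_int_add[OF disjI1[OF z]] step_phase_def by simp
  also have "z ^ ?x * step_phase L z ?c * (\<Sum>b<L. local_coin_M L $$ (?c, b) * w $ b)
      = z ^ ?x * (?B *\<^sub>v w) $ ?c"
    using c w local_coin_M_index[OF assms(1) c]
    by (auto simp: walk_block_def scalar_prod_def atLeast0LessThan sum_distrib_left intro!: sum.cong)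
  also have "\<dots> = plane_wave N z (?B *\<^sub>v w) $ i"
    using plane_wave_index[OF Bw i] by simp
  finally show "(grover_walk_M L N *\<^sub>v plane_wave N z w) $ i = plane_wave N z (?B *\<^sub>v w) $ i" .
qed

lemma grover_walk_M_pow_plane_wave:
  assumes "odd L" "z ^ N = 1" and w: "w \<in> carrier_vec L"
  shows "grover_walk_M L N ^\<^sub>m n *\<^sub>v plane_wave N z w
    = plane_wave N z (walk_block L (step_phase L z) ^\<^sub>m n *\<^sub>v w)"
  using w
proof (induction n arbitrary: w)
  case 0
  then show ?case
    using carrier_matD(1)[OF grover_walk_M_carrier[of L N]] by (simp add: walk_block_def)
next
  case (Suc n)
  let ?B = "walk_block L (step_phase L z)"
  have "grover_walk_M L N ^\<^sub>m Suc n *\<^sub>v plane_wave N z w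
      = grover_walk_M L N ^\<^sub>m n *\<^sub>v (grover_walk_M L N *\<^sub>v plane_wave N z w)"
    using Suc.prems
    by (simp add: assoc_mult_mat_vec[OF pow_carrier_mat[OF grover_walk_M_carrier] grover_walk_M_carrier])
  also have "\<dots> = plane_wave N z (?B ^\<^sub>m n *\<^sub>v (?B *\<^sub>v w))"
    using Suc.prems by (simp add: grover_walk_M_plane_wave[OF assms(1,2)] Suc.IH)
  also have "?B ^\<^sub>m n *\<^sub>v (?B *\<^sub>v w) = ?B ^\<^sub>m Suc n *\<^sub>v w"
    using Suc.prems
    by (simp add: assoc_mult_mat_vec[OF pow_carrier_mat[OF walk_block_carrier] walk_block_carrier])
  finally show ?case .
qed

lemma mat_eq_1_if_fixes:
  fixes A :: "'a :: semiring_1 mat"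
  assumes A: "A \<in> carrier_mat n n" and fixes_vec: "\<And>v. v \<in> carrier_vec n \<Longrightarrow> A *\<^sub>v v = v"
  shows "A = 1\<^sub>m n"
proof (rule eq_matI)
  fix i j assume ij: "i < dim_row (1\<^sub>m n :: 'a mat)" "j < dim_col (1\<^sub>m n :: 'a mat)"
  then have "(A *\<^sub>v unit_vec n j) $ i = unit_vec n j $ i"
    using fixes_vec[of "unit_vec n j"] by simp
  then show "A $$ (i, j) = 1\<^sub>m n $$ (i, j)"
    using A ij scalar_prod_right_unit[of j n "row A i"] by auto
qed (use A in auto)

text \<open>Fourier inversion: every basis vector is an average of plane waves.\<close>

lemma mat_eq_1_if_fixes_plane_waves:
  assumes A: "A \<in> carrier_mat (N * L) (N * L)"
    and fixes_wave: "\<And>z w. z ^ N = 1 \<Longrightarrow> w \<in> carrier_vec L \<Longrightarrow> A *\<^sub>v plane_wave N z w = plane_wave N z w"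
  shows "A = 1\<^sub>m (N * L)"
proof (rule eq_matI)
  fix i j assume "i < dim_row (1\<^sub>m (N * L) :: complex mat)" "j < dim_col (1\<^sub>m (N * L) :: complex mat)"
  then have i: "i < N * L" and j: "j < N * L" by auto
  have "N > 0" using i by (auto intro!: gr0I)
  let ?R = "{z :: complex. z ^ N = 1}"
  let ?e = "unit_vec L (j mod L) :: complex vec"
  have e: "?e \<in> carrier_vec L" by simp
  \<comment> \<open>Weighting by the inverse character at position \<open>j div L\<close> makes
    \<open>f\<close>, by orthogonality, \<open>N\<close> times the basis vector number
    \<open>j\<close>. Being a combination of plane waves, it is fixed by \<open>A\<close>.\<close>
  define f where "f l = (\<Sum>z\<in>?R. z powi (- int (j div L)) * plane_wave N z ?e $ l)" for l
  have f: "f l = of_nat N * 1\<^sub>m (N * L) $$ (l, j)" if l: "l < N * L" for l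
  proof -
    have lt: "l mod L < L" "j mod L < L" using l by (auto intro!: mod_less_divisor gr0I)
    have "f l = (\<Sum>z\<in>?R. z powi (int (l div L) - int (j div L)) * ?e $ (l mod L))"
      unfolding f_def
    proof (rule sum.cong[OF refl])
      fix z :: complex assume "z \<in> ?R"
      then have z: "z \<noteq> 0" using \<open>N > 0\<close> by (auto simp: power_0_left)
      have "z powi (int (l div L) - int (j div L)) = z powi (- int (j div L)) * z ^ (l div L)"
        using power_int_add[OF disjI1[OF z], of "- int (j div L)" "int (l div L)"] by simp
      then show "z powi (- int (j div L)) * plane_wave N z ?e $ l
          = z powi (int (l div L) - int (j div L)) * ?e $ (l mod L)"
        by (simp add: plane_wave_index[OF e l])
    qed
    also have "\<dots> = (if int N dvd int (l div L) - int (j div L) then of_nat N else 0) * ?e $ (l mod L)"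
      by (simp add: sum_roots_of_unity_powi[OF \<open>N > 0\<close>] flip: sum_distrib_right)
    also have "int N dvd int (l div L) - int (j div L) \<longleftrightarrow> l div L = j div L"
      using less_mult_imp_div_less[OF l] less_mult_imp_div_less[OF j]
      by (simp flip: mod_eq_dvd_iff)
    also have "(if l div L = j div L then of_nat N else 0) * ?e $ (l mod L) = of_nat N * 1\<^sub>m (N * L) $$ (l, j)"
      using lt l j by (auto simp: unit_vec_def) (metis div_mult_mod_eq)
    finally show ?thesis .
  qed
  have "(\<Sum>l<N * L. A $$ (i, l) * f l) = f i"
  proof -
    have "(\<Sum>l<N * L. A $$ (i, l) * f l)
        = (\<Sum>z\<in>?R. z powi (- int (j div L)) * (\<Sum>l<N * L. A $$ (i, l) * plane_wave N z ?e $ l))"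
      unfolding f_def sum_distrib_left by (subst sum.swap) (simp add: mult_ac)
    also have "\<dots> = (\<Sum>z\<in>?R. z powi (- int (j div L)) * (A *\<^sub>v plane_wave N z ?e) $ i)"
      using A i by (simp add: scalar_prod_def atLeast0LessThan)
    also have "\<dots> = f i" unfolding f_def using fixes_wave[OF _ e] by (intro sum.cong) auto
    finally show ?thesis .
  qed
  also have "(\<Sum>l<N * L. A $$ (i, l) * f l) = (\<Sum>l<N * L. if l = j then of_nat N * A $$ (i, j) else 0)"
    using j by (intro sum.cong) (auto simp: f)
  also have "\<dots> = of_nat N * A $$ (i, j)" using j by simp
  finally show "A $$ (i, j) = 1\<^sub>m (N * L) $$ (i, j)" using f[OF i] \<open>N > 0\<close> by simp
qed (use A in auto)

lemma grover_walk_M_pow_eq_1_iff: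
  assumes "odd L" "N > 0"
  shows "grover_walk_M L N ^\<^sub>m n = 1\<^sub>m (N * L)
    \<longleftrightarrow> (\<forall>z. z ^ N = 1 \<longrightarrow> walk_block L (step_phase L z) ^\<^sub>m n = 1\<^sub>m L)"
proof safe
  fix z :: complex
  let ?B = "walk_block L (step_phase L z)"
  assume U: "grover_walk_M L N ^\<^sub>m n = 1\<^sub>m (N * L)" and z: "z ^ N = 1"
  show "?B ^\<^sub>m n = 1\<^sub>m L"
  proof (rule mat_eq_1_if_fixes)
    fix w :: "complex vec" assume w: "w \<in> carrier_vec L"
    have Bw: "?B ^\<^sub>m n *\<^sub>v w \<in> carrier_vec L" by (rule mult_mat_vec_carrier[OF pow_carrier_mat[OF walk_block_carrier] w])
    have wave: "plane_wave N z (?B ^\<^sub>m n *\<^sub>v w) = plane_wave N z w"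
      using grover_walk_M_pow_plane_wave[OF assms(1) z w, of n] U w by simp
    show "?B ^\<^sub>m n *\<^sub>v w = w"
    proof (rule eq_vecI)
      fix c assume "c < dim_vec w"
      \<comment> \<open>Indices below \<open>L\<close> belong to position \<open>0\<close>, where
        the wave factor is \<open>z ^ 0 = 1\<close>; so \<open>w\<close> can be read off its plane
        wave.\<close>
      then have c: "c < L" "c < N * L" using w index_less_prod[of 0 N c L] assms(2) by auto
      show "(?B ^\<^sub>m n *\<^sub>v w) $ c = w $ c"
        using plane_wave_index[OF Bw c(2), of z] plane_wave_index[OF w c(2), of z] wave c(1) by simp
    qed (use Bw w in auto)
  qed simp
next
  assume B: "\<forall>z. z ^ N = 1 \<longrightarrow> walk_block L (step_phase L z) ^\<^sub>m n = 1\<^sub>m L"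
  show "grover_walk_M L N ^\<^sub>m n = 1\<^sub>m (N * L)"
    by (rule mat_eq_1_if_fixes_plane_waves)
      (use B in \<open>simp_all add: grover_walk_M_pow_plane_wave[OF assms(1)]\<close>)
qed

section \<open>Period of the walk\<close>

lemma grover_walk_M_pow_eq_1_imp_dvd:
  assumes L: "odd L" "L \<ge> 3" and "N > 0" "n > 0"
    and U: "grover_walk_M L N ^\<^sub>m n = 1\<^sub>m (N * L)"
  shows "N dvd L"
proof (cases "N = 1")
  case False
  \<comment> \<open>One ring must contain the \<open>N\<close>-th roots of unity that occur in
    \<open>step_sum\<close> and the \<open>n\<close>-th roots of unity that are the
    eigenvalues.\<close>
  define M where "M = N * n"
  have M: "M > 0" using assms by (simp add: M_def)
  let ?s = "step_sum L" and ?h = "of_int (int (half_range L)) :: complex"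
  have "?s z / of_nat L \<in> cyclotomic_ints M" if z: "z ^ N = 1" for z
  proof -
    have "walk_block L (step_phase L z) ^\<^sub>m n = 1\<^sub>m L"
      using U z grover_walk_M_pow_eq_1_iff[OF L(1) \<open>N > 0\<close>] by blast
    from trace_finite_order[OF walk_block_carrier this]
    obtain es where es: "\<And>e. e \<in> set es \<Longrightarrow> e ^ n = 1"
      and tr: "(2 / of_nat L - 1) * ?s z = sum_list es"
      unfolding trace_walk_block_phase by blast
    have t: "sum_list es \<in> cyclotomic_ints M"
      using root_of_unity_in_cyclotomic_ints[OF M es] by (intro cyclotomic_ints_sum_list) (auto simp: M_def)
    have s: "?s z \<in> cyclotomic_ints M"
      unfolding step_sum_def
    proof (intro cyclotomic_ints_sum root_of_unity_in_cyclotomic_ints[OF M, of _ N])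
      fix c show "(z powi (int (half_range L) - int c)) ^ N = 1"
        using z by (simp add: power_int_power' mult.commute[of _ "int N"] power_int_mult)
    qed (simp add: M_def)
    have "of_nat L = (of_int (int L) :: complex)" by simp
    also have "\<dots> = 2 * ?h + 1" unfolding half_range_odd[OF L(1)] by simp
    finally have Lh: "of_nat L = 2 * ?h + 1" .
    have L0: "of_nat L \<noteq> (0 :: complex)" using L(2) by simp
    \<comment> \<open>The trace plus \<open>?s z\<close> is \<open>2 * ?s z / L\<close>. Since
      \<open>L - 2 * ?h = 1\<close>, subtracting \<open>?h\<close> times this from
      \<open>?s z\<close> leaves \<open>?s z / L\<close>.\<close>
    have "?s z - ?h * (sum_list es + ?s z) = ?s z * (of_nat L - 2 * ?h) / of_nat L"
      using L0 unfolding tr[symmetric] by (simp add: field_simps)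
    also have "\<dots> = ?s z / of_nat L" unfolding Lh by simp
    finally show ?thesis
      using cyclotomic_ints_diff[OF s cyclotomic_ints_mult[OF of_int_in_cyclotomic_ints cyclotomic_ints_add[OF t s]]]
      by metis
  qed
  \<comment> \<open>For a primitive \<open>N\<close>-th root, \<open>z ^ L = 1\<close> already means
    that \<open>N\<close> divides \<open>L\<close>.\<close>
  moreover define z where "z = cis (2 * pi / real N)"
  have z: "z ^ N = 1" "z \<noteq> 1"
    using cis_root_of_unity[OF \<open>N > 0\<close>] cis_powi_eq_1_iff[OF \<open>N > 0\<close>, of 1] False by (auto simp: z_def)
  ultimately have "?s z = 0"
    by (intro step_sum_integral_imp_zero[OF L \<open>N > 0\<close> M]) auto
  then have "z powi int L = 1"
    using step_sum_eq_0_iff[OF L(1) _ z(2)] by (simp add: z_def)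
  then show ?thesis using cis_powi_eq_1_iff[OF \<open>N > 0\<close>, of "int L"] by (simp add: z_def)
qed simp

text \<open>The block at \<open>z = 1\<close> has order \<open>2\<close>, and every other block has
  order \<open>L\<close>, because no block is the identity and both numbers are prime. As
  \<open>L\<close> is odd, the common order is \<open>2 * L\<close>.\<close>

lemma grover_walk_M_pow_eq_1_iff_dvd:
  assumes "prime L" "L \<ge> 3"
  shows "grover_walk_M L L ^\<^sub>m n = 1\<^sub>m (L * L) \<longleftrightarrow> 2 * L dvd n"
proof -
  have odd: "odd L" using assms prime_odd_nat[of L] by auto
  have L0: "L > 0" using assms by simp
  have iff: "grover_walk_M L L ^\<^sub>m n = 1\<^sub>m (L * L)
      \<longleftrightarrow> (\<forall>z. z ^ L = 1 \<longrightarrow> walk_block L (step_phase L z) ^\<^sub>m n = 1\<^sub>m L)"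
    by (rule grover_walk_M_pow_eq_1_iff[OF odd L0])
  have block: "walk_block L (step_phase L z) \<noteq> 1\<^sub>m L" if "z ^ L = 1" for z
    using that assms by (intro walk_block_neq_1) (auto simp: step_phase_def power_0_left)
  have invol: "walk_block L (step_phase L 1) ^\<^sub>m 2 = 1\<^sub>m L"
    unfolding step_phase_1 by (rule walk_block_involution[OF L0])
  show ?thesis
    unfolding iff
  proof
    assume B: "\<forall>z. z ^ L = 1 \<longrightarrow> walk_block L (step_phase L z) ^\<^sub>m n = 1\<^sub>m L"
    have "even n"
    proof (rule ccontr)
      assume "odd n"
      then have "coprime 2 n" by simp
      then show False
        using pow_mat_coprime_eq_1[OF walk_block_carrier invol, of n] B block[of 1] by simp
    qed
    moreover have "L dvd n"
    proof (rule ccontr)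
      assume "\<not> L dvd n"
      then have cop: "coprime L n" by (rule prime_imp_coprime[OF assms(1)])
      define z where "z = cis (2 * pi / real L)"
      have z: "z ^ L = 1" "z \<noteq> 1"
        using cis_root_of_unity[OF L0] cis_powi_eq_1_iff[OF L0, of 1] assms(2) by (auto simp: z_def)
      show False
        using pow_mat_coprime_eq_1[OF walk_block_carrier walk_block_phase_pow_L[OF assms(1) odd z] _ cop L0]
          B z(1) block[OF z(1)] by blast
    qed
    ultimately show "2 * L dvd n"
      using odd by (intro divides_mult) auto
  next
    assume "2 * L dvd n"
    then obtain k where n: "n = 2 * L * k" by blast
    show "\<forall>z. z ^ L = 1 \<longrightarrow> walk_block L (step_phase L z) ^\<^sub>m n = 1\<^sub>m L"
    proof (intro allI impI)
      fix z :: complex assume z: "z ^ L = 1"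
      show "walk_block L (step_phase L z) ^\<^sub>m n = 1\<^sub>m L"
      proof (cases "z = 1")
        case True
        then show ?thesis
          using pow_mat_mult_eq_1[OF walk_block_carrier invol, of "L * k"] n by (simp add: mult.assoc)
      next
        case False
        then show ?thesis
          using pow_mat_mult_eq_1[OF walk_block_carrier walk_block_phase_pow_L[OF assms(1) odd z False], of "2 * k"] n
          by (simp add: mult_ac)
      qed
    qed
  qed
qed

theorem theorem4p1:
  fixes L N :: nat
  assumes "prime L" and "L \<ge> 3" and "N \<ge> 2"
  shows "period_M L N = (if N = L then enat (2 * L) else \<infinity>)"
proof (cases "N = L")
  case True
  let ?P = "{n. n \<ge> 1 \<and> 2 * L dvd n}"
  have "period_M L N = Inf (enat ` ?P)"
    by (simp add: period_M_def True grover_walk_M_pow_eq_1_iff_dvd[OF assms(1,2)])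
  also have "\<dots> = enat (2 * L)"
  proof (rule antisym)
    show "Inf (enat ` ?P) \<le> enat (2 * L)" using assms(2) by (intro Inf_lower) auto
    show "enat (2 * L) \<le> Inf (enat ` ?P)" by (intro Inf_greatest) (auto dest: dvd_imp_le)
  qed
  finally show ?thesis using True by simp
next
  case False
  have "odd L" using assms prime_odd_nat[of L] by auto
  \<comment> \<open>The divisors of the prime \<open>L\<close> are \<open>1\<close> and
    \<open>L\<close>, both excluded here.\<close>
  moreover have "\<not> N dvd L"
    using False assms(3) prime_nat_iff[of L] assms(1) by auto
  ultimately have "grover_walk_M L N ^\<^sub>m n \<noteq> 1\<^sub>m (N * L)" if "n \<ge> 1" for n
    using grover_walk_M_pow_eq_1_imp_dvd[of L N n] assms(2,3) that by auto
  then have "{n. n \<ge> 1 \<and> grover_walk_M L N ^\<^sub>m n = 1\<^sub>m (N * L)} = {}" by auto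
  then show ?thesis using False by (simp only: period_M_def) (simp add: top_enat_def)
qed

end
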